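(* Let $k$ be a positive integer, and for $s=1,2$ let $w_s\in\mathbb{Z}/k\mathbb{Z}$ be an element of multiplicative order $c_s$, where $c_s\mid k$. If $G(k,c_1,w_1)\cong G(k,c_2,w_2)$ as directed graphs, then the maps $x\mapsto w_1x$ and $x\mapsto w_2x$ are permutations of $\mathbb{Z}/k\mathbb{Z}$ of the same cycle type. In particular, $c_1=c_2$.
   Context: For a positive integer $k$ and an element $w$ of multiplicative order $c$ in $\mathbb{Z}/k\mathbb{Z}$ (so $w$ is a unit mod $k$) with $c\mid k$, the directed graph $G(k,c,w)$ (loops allowed) has vertex set $\mathbb{Z}/k\mathbb{Z}\times\mathbb{Z}/k\mathbb{Z}$, and its edges are all the directed edges $(p,i)\to(p+w^j i,\,j)$ with $p,i,j\in\mathbb{Z}/k\mathbb{Z}$. Here $w^j$ for $j\in\mathbb{Z}/k\mathbb{Z}$ is well defined because $c\mid k$. *)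

theory Defs
  imports
    "HOL-Library.Multiset"
    "HOL-Combinatorics.Orbits"
    "HOL-Number_Theory.Pocklington"
    "Graph_Theory.Pair_Digraph"
    "Graph_Theory.Digraph_Isomorphism"
begin

text \<open>
  The ring of integers modulo \<open>k\<close> is represented by the least nonnegative residues \<open>{..<k}\<close>,
  with arithmetic reduced modulo \<open>k\<close>.  The parameter \<open>c\<close> of the graph \<open>G(k, c, w)\<close> is
  the order of \<open>w\<close>, hence determined by \<open>k\<close> and \<open>w\<close>, and is not repeated as an argument.
  An arc is determined by its two endpoints: \<open>p\<close>, \<open>i\<close> and \<open>j\<close> can be read off from them, so
  there are no parallel arcs, and a set of pairs loses nothing.
\<close>

definition G_graph :: "nat \<Rightarrow> nat \<Rightarrow> (nat \<times> nat) pair_pre_digraph" where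
  "G_graph k w =
     \<lparr> pverts = {..<k} \<times> {..<k},
       parcs = {((p, i), ((p + w ^ j * i) mod k, j)) | p i j. p < k \<and> i < k \<and> j < k} \<rparr>"

text \<open>
  The exponent \<open>j\<close> is a residue modulo \<open>k\<close>; the choice of its representative does not matter
  when the order of \<open>w\<close> divides \<open>k\<close>.
\<close>

lemma power_residue_exponent_cong:
  fixes k w j j' :: nat
  assumes "coprime k w" and "ord k w dvd k" and "[j = j'] (mod k)"
  shows "[w ^ j = w ^ j'] (mod k)"
  using assms order_divides_expdiff cong_dvd_modulus_nat by blast

text \<open>The library's notion of digraph isomorphism presupposes a well-formed digraph.\<close>

lemma wf_digraph_G_graph: "wf_digraph (with_proj (G_graph k w))"
  by unfold_locales (auto simp: G_graph_def)

definition mult_mod :: "nat \<Rightarrow> nat \<Rightarrow> nat \<Rightarrow> nat" where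
  "mult_mod k w x = (w * x) mod k"

text \<open>
  The multiset of cycle lengths of a permutation \<open>f\<close> of a finite set \<open>A\<close>, fixed points included
  as cycles of length one.  Each cycle is counted once, since \<open>mset_set\<close> is applied to the set
  of orbits.
\<close>

definition cycle_type :: "'a set \<Rightarrow> ('a \<Rightarrow> 'a) \<Rightarrow> nat multiset" where
  "cycle_type A f = image_mset card (mset_set (orbit f ` A))"

end

theory Submission
  imports Defs
begin

text \<open>
  Call the number of common out-neighbours of two vertices their codegree.  For an isomorphism
  invariant it is remarkably informative here: the arcs with the same \<open>j\<close> out of \<open>(p, i)\<close> and
  \<open>(p - e, i + d)\<close> meet exactly when \<open>w\<^sup>j d = e\<close>.  As \<open>j\<close> runs over all residues modulo
  \<open>k\<close>, the values \<open>w\<^sup>j d\<close> run through the cycle of \<open>d\<close> under multiplication by \<open>w\<close>, and each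
  is attained equally often.  So the codegree is \<open>0\<close> if \<open>e\<close> lies outside that cycle, and is
  \<open>k\<close> divided by the length of the cycle otherwise (lemma \<open>card_exponents_times_card_orbit\<close>).

  Fix a vertex and a length \<open>L\<close>.  The vertices whose codegree with it is \<open>k / L\<close> correspond
  to the pairs \<open>(d, e)\<close> with \<open>d\<close> on a cycle of length \<open>L\<close> and \<open>e\<close> on the cycle of \<open>d\<close>; there are
  \<open>L\<close> times as many of them as residues on cycles of length \<open>L\<close> (lemma
  \<open>card_vertices_of_codegree\<close>).  The graph thus determines the number of residues on cycles
  of each length, and so the cycle type.  The order of \<open>w\<close> is the length of the longest
  cycle, namely that of \<open>1\<close>, so the cycle type determines the order.
\<close>

section \<open>Codegrees in digraphs\<close>

definition codegree :: "('a, 'b) pre_digraph \<Rightarrow> 'a \<Rightarrow> 'a \<Rightarrow> nat" where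
  "codegree G u v = card {z \<in> verts G. (u, z) \<in> arcs_ends G \<and> (v, z) \<in> arcs_ends G}"

lemma digraph_iso_vertex_bijection:
  assumes "digraph_iso G H"
  obtains f where "bij_betw f (verts G) (verts H)"
    and "\<And>u v. u \<in> verts G \<Longrightarrow> v \<in> verts G \<Longrightarrow>
           (f u, f v) \<in> arcs_ends H \<longleftrightarrow> (u, v) \<in> arcs_ends G"
proof -
  obtain h where h: "pre_digraph.digraph_isomorphism G h" and H: "H = app_iso h G"
    using assms by (auto simp: digraph_iso_def)
  let ?f = "iso_verts h"
  have wf: "wf_digraph G" and inj: "inj_on ?f (verts G)"
    using h by (auto simp: pre_digraph.digraph_isomorphism_def)
  have ends: "arcs_ends H = (\<lambda>a. (?f (tail G a), ?f (head G a))) ` arcs G"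
    using h by (force simp: H arcs_ends_def arc_to_ends_def pre_digraph.digraph_isomorphism_def)
  show thesis
  proof
    show "bij_betw ?f (verts G) (verts H)"
      using inj by (simp add: H bij_betw_def)
    show "(?f u, ?f v) \<in> arcs_ends H \<longleftrightarrow> (u, v) \<in> arcs_ends G"
      if "u \<in> verts G" "v \<in> verts G" for u v
    proof -
      have "(?f u, ?f v) \<in> arcs_ends H \<longleftrightarrow>
          (\<exists>a\<in>arcs G. ?f u = ?f (tail G a) \<and> ?f v = ?f (head G a))"
        by (auto simp: ends)
      also have "\<dots> \<longleftrightarrow> (\<exists>a\<in>arcs G. u = tail G a \<and> v = head G a)"
        using that wf_digraph.tail_in_verts[OF wf] wf_digraph.head_in_verts[OF wf]
        by (intro bex_cong) (simp_all add: inj_on_eq_iff[OF inj])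
      also have "\<dots> \<longleftrightarrow> (u, v) \<in> arcs_ends G"
        by (auto simp: arcs_ends_def arc_to_ends_def)
      finally show ?thesis .
    qed
  qed
qed

lemma card_Collect_bij_betw:
  assumes "bij_betw f A B"
  shows "card {y \<in> B. P y} = card {x \<in> A. P (f x)}"
proof -
  have "{y \<in> B. P y} = f ` {x \<in> A. P (f x)}"
    using assms by (auto simp: bij_betw_def)
  moreover have "inj_on f {x \<in> A. P (f x)}"
    using assms by (auto simp: bij_betw_def intro: inj_on_subset)
  ultimately show ?thesis
    by (simp add: card_image)
qed

lemma digraph_iso_card_codegree:
  assumes "digraph_iso G H"
  obtains f where "bij_betw f (verts G) (verts H)"
    and "\<And>u P. u \<in> verts G \<Longrightarrow>
           card {v \<in> verts H. P (codegree H (f u) v)} = card {v \<in> verts G. P (codegree G u v)}"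
proof -
  obtain f where f: "bij_betw f (verts G) (verts H)"
    and arcs: "\<And>u v. u \<in> verts G \<Longrightarrow> v \<in> verts G \<Longrightarrow>
           (f u, f v) \<in> arcs_ends H \<longleftrightarrow> (u, v) \<in> arcs_ends G"
    using digraph_iso_vertex_bijection[OF assms] by blast
  have codeg: "codegree H (f u) (f v) = codegree G u v" if "u \<in> verts G" "v \<in> verts G" for u v
    unfolding codegree_def card_Collect_bij_betw[OF f]
    using that by (intro arg_cong[of _ _ card]) (auto simp: arcs)
  show thesis
  proof
    show "card {v \<in> verts H. P (codegree H (f u) v)} = card {v \<in> verts G. P (codegree G u v)}"
      if "u \<in> verts G" for u P
      unfolding card_Collect_bij_betw[OF f]
      using that by (intro arg_cong[of _ _ card]) (auto simp: codeg)
  qed (fact f)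
qed

section \<open>Cycle types from orbit sizes\<close>

text \<open>
  Recurrence of every point makes the orbits a partition of \<open>A\<close>, and each orbit of size \<open>L\<close>
  contributes \<open>L\<close> points.
\<close>

lemma count_cycle_type:
  assumes "finite A" and maps: "f \<in> A \<rightarrow> A" and self: "\<And>x. x \<in> A \<Longrightarrow> x \<in> orbit f x"
  shows "L * count (cycle_type A f) L = card {x \<in> A. card (orbit f x) = L}"
proof -
  let ?C = "{S \<in> orbit f ` A. card S = L}"
  have sub: "orbit f x \<subseteq> A" if "x \<in> A" for x
  proof
    fix y assume "y \<in> orbit f x"
    then show "y \<in> A" by induction (use maps that in auto)
  qed
  have eq: "orbit f y = orbit f x" if "x \<in> A" "y \<in> orbit f x" for x y
    using that self orbit_swap orbit_trans by (metis subsetI subset_antisym)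
  have union: "\<Union> ?C = {x \<in> A. card (orbit f x) = L}"
  proof (intro equalityI subsetI)
    fix x assume "x \<in> \<Union> ?C"
    then obtain y where y: "y \<in> A" "x \<in> orbit f y" "card (orbit f y) = L" by auto
    then show "x \<in> {x \<in> A. card (orbit f x) = L}" using sub[OF y(1)] eq[OF y(1,2)] y by auto
  next
    fix x assume "x \<in> {x \<in> A. card (orbit f x) = L}"
    then show "x \<in> \<Union> ?C" using self by auto
  qed
  have "count (cycle_type A f) L = card ?C"
    unfolding cycle_type_def count_image_mset using assms(1)
    by (auto simp: vimage_def Int_def conj_commute intro!: arg_cong[of _ _ card])
  also have "L * card ?C = card (\<Union> ?C)"
  proof (rule card_partition)
    show "finite ?C" using assms(1) by simp
    show "finite (\<Union> ?C)" using union assms(1) by simp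
    show "S \<inter> T = {}" if "S \<in> ?C" "T \<in> ?C" "S \<noteq> T" for S T
      using that eq by (smt (verit) disjoint_iff imageE mem_Collect_eq)
  qed simp
  finally show ?thesis using union by simp
qed

text \<open>
  The factor \<open>L\<close> loses nothing: there are no empty orbits.
\<close>

lemma cycle_type_eqI:
  assumes "finite A" "f \<in> A \<rightarrow> A" "\<And>x. x \<in> A \<Longrightarrow> x \<in> orbit f x"
    and "finite B" "g \<in> B \<rightarrow> B" "\<And>x. x \<in> B \<Longrightarrow> x \<in> orbit g x"
    and cards: "\<And>L. L > 0 \<Longrightarrow>
      card {x \<in> A. card (orbit f x) = L} = card {x \<in> B. card (orbit g x) = L}"
  shows "cycle_type A f = cycle_type B g"
proof (rule multiset_eqI)
  fix L
  show "count (cycle_type A f) L = count (cycle_type B g) L"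
  proof (cases "L = 0")
    case True
    have "0 \<notin># cycle_type A f" "0 \<notin># cycle_type B g"
      using assms(1,3,4,6) finite_orbit by (fastforce simp: cycle_type_def)+
    then show ?thesis using True by (simp add: not_in_iff)
  next
    case False
    then have "L * count (cycle_type A f) L = L * count (cycle_type B g) L"
      using count_cycle_type[of A f L, OF assms(1,2) assms(3)]
        count_cycle_type[of B g L, OF assms(4,5) assms(6)] cards[of L]
      by linarith
    then show ?thesis using False by simp
  qed
qed

section \<open>Multiplication by a unit modulo k\<close>

lemma inj_on_add_mod: "inj_on (\<lambda>x. (a + x) mod k) {..<k}" for k :: nat
  by (rule inj_onI) (metis cong_add_lcancel_nat cong_def lessThan_iff mod_less)

lemma bij_betw_mult_mod:
  assumes "coprime k w"
  shows "bij_betw (mult_mod k w) {..<k} {..<k}"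
proof (cases "k = 0")
  case False
  have "inj_on (mult_mod k w) {..<k}"
  proof (rule inj_onI)
    fix x y assume "x \<in> {..<k}" "y \<in> {..<k}" "mult_mod k w x = mult_mod k w y"
    then show "x = y"
      using cong_mult_lcancel_nat[of w k x y] assms
      by (simp add: mult_mod_def cong_def coprime_commute)
  qed
  moreover have "mult_mod k w ` {..<k} \<subseteq> {..<k}"
    using False by (auto simp: mult_mod_def)
  ultimately show ?thesis
    by (simp add: bij_betw_def endo_inj_surj)
qed (simp add: bij_betw_def)

lemma funpow_mult_mod: "d < k \<Longrightarrow> (mult_mod k w ^^ n) d = w ^ n * d mod k"
  by (induction n) (simp_all add: mult_mod_def mod_simps mult.assoc)

lemma orbit_mult_mod_bounded:
  assumes "[w ^ n = 1] (mod k)" "n > 0" "d < k"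
  shows "orbit (mult_mod k w) d = (\<lambda>j. w ^ j * d mod k) ` {..<n}"
proof -
  have "w ^ n * d mod k = d"
    using cong_scalar_right[OF assms(1), of d] assms(3) by (simp add: cong_def)
  then show ?thesis
    using orbit_altdef_bounded[of n "mult_mod k w" d] assms(2,3)
    by (auto simp: funpow_mult_mod)
qed

text \<open>
  The cycle of \<open>1\<close> consists of the distinct powers of \<open>w\<close>, and every other cycle is the
  image of that one under \<open>x \<mapsto> x d\<close> for some \<open>d\<close>, so it is no longer.
\<close>

lemma ord_eq_Max_cycle_type:
  assumes "k > 0" "coprime k w"
  shows "ord k w = Max (set_mset (cycle_type {..<k} (mult_mod k w)))"
proof -
  let ?f = "mult_mod k w"
  have pos: "ord k w > 0" using assms(2) by (simp add: ord_eq_0)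
  note orb = orbit_mult_mod_bounded[OF ord pos]
  have le: "card (orbit ?f d) \<le> ord k w" if "d < k" for d
    unfolding orb[OF that] using card_image_le[of "{..<ord k w}"] by simp
  \<comment> \<open>For \<open>k = 1\<close> the residue of \<open>1\<close> is \<open>0\<close>, hence the reduction.\<close>
  have "orbit ?f (1 mod k) = (\<lambda>j. w ^ j mod k) ` {..<ord k w}"
    using orb[of "1 mod k"] assms(1) by (simp add: mod_simps)
  moreover have "inj_on (\<lambda>j. w ^ j mod k) {..<ord k w}"
    using order_divides_expdiff[OF assms(2)]
    by (auto simp: inj_on_def cong_def)
  ultimately have "card (orbit ?f (1 mod k)) = ord k w"
    by (simp add: card_image)
  then have "ord k w \<in> card ` orbit ?f ` {..<k}"
    using assms(1) by (metis imageI lessThan_iff mod_less_divisor)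
  then have "Max (card ` orbit ?f ` {..<k}) = ord k w"
    using le by (intro Max_eqI) auto
  then show ?thesis by (simp add: cycle_type_def)
qed

context
  fixes k w :: nat
  assumes k_pos: "k > 0" and period: "[w ^ k = 1] (mod k)"
begin

lemma power_mod_exponent: "w ^ (n mod k) * d mod k = w ^ n * d mod k"
proof -
  have "[w ^ (k * (n div k) + n mod k) = 1 ^ (n div k) * w ^ (n mod k)] (mod k)"
    unfolding power_add power_mult by (intro cong_mult cong_pow period cong_refl)
  then have "[w ^ n = w ^ (n mod k)] (mod k)" by simp
  then show ?thesis by (metis cong_def cong_scalar_right)
qed

lemmas orbit_mult_mod = orbit_mult_mod_bounded[OF period k_pos]

lemma self_in_orbit_mult_mod: "d < k \<Longrightarrow> d \<in> orbit (mult_mod k w) d"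
  using k_pos by (auto simp: orbit_mult_mod intro!: image_eqI[of _ _ 0])

lemma mult_mod_maps: "mult_mod k w \<in> {..<k} \<rightarrow> {..<k}"
  using k_pos by (auto simp: mult_mod_def)

text \<open>
  Shifting the exponents by \<open>t\<close> modulo \<open>k\<close> carries those that fix \<open>d\<close> to those that send
  \<open>d\<close> to \<open>w\<^sup>t d\<close>, and, as \<open>w\<^sup>k = 1\<close>, shifting by \<open>k - t\<close> carries them back.  So all points of a cycle are
  reached by equally many of the \<open>k\<close> exponents.
\<close>

lemma card_exponents_times_card_orbit:
  assumes d: "d < k" and e: "e \<in> orbit (mult_mod k w) d"
  shows "card {j. j < k \<and> w ^ j * d mod k = e} * card (orbit (mult_mod k w) d) = k"
proof -
  let ?F = "\<lambda>e. {j. j < k \<and> w ^ j * d mod k = e}"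
  let ?O = "orbit (mult_mod k w) d"
  have shift: "card (?F x) \<le> card (?F y)" if "w ^ t * x mod k = y" for t x y
  proof (rule card_inj_on_le)
    show "inj_on (\<lambda>j. (t + j) mod k) (?F x)"
      by (rule inj_on_subset[OF inj_on_add_mod]) auto
    have "w ^ ((t + j) mod k) * d mod k = y" if "w ^ j * d mod k = x" for j
    proof -
      have "w ^ ((t + j) mod k) * d mod k = w ^ t * (w ^ j * d mod k) mod k"
        by (simp add: power_mod_exponent power_add mult.assoc mod_simps)
      then show ?thesis using that \<open>w ^ t * x mod k = y\<close> by simp
    qed
    then show "(\<lambda>j. (t + j) mod k) ` ?F x \<subseteq> ?F y"
      using k_pos by auto
  qed simp
  have const: "card (?F y) = card (?F d)" if "y \<in> ?O" for y
  proof -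
    obtain t where t: "t < k" "w ^ t * d mod k = y"
      using \<open>y \<in> ?O\<close> by (auto simp: orbit_mult_mod[OF d])
    have "w ^ (k - t) * y mod k = w ^ (k - t + t) * d mod k"
      by (simp only: t(2)[symmetric] power_add mod_mult_right_eq mult.assoc)
    also have "\<dots> = d"
      using t(1) d power_mod_exponent[of k d] by simp
    finally have unshift: "w ^ (k - t) * y mod k = d" .
    show ?thesis by (rule order_antisym[OF shift[OF unshift] shift[OF t(2)]])
  qed
  have "k = (\<Sum>j<k. 1::nat)" by simp
  also have "\<dots> = (\<Sum>y\<in>?O. card (?F y))"
    unfolding orbit_mult_mod[OF d]
    using sum.image_gen[of "{..<k}" "\<lambda>_. 1::nat" "\<lambda>j. w ^ j * d mod k"] by simp
  also have "\<dots> = card ?O * card (?F d)" by (simp add: const)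
  finally show ?thesis using const[OF e] by (simp add: mult.commute)
qed

lemma card_exponents_times_eq_iff:
  assumes "d < k"
  shows "card {j. j < k \<and> w ^ j * d mod k = e} * L = k \<longleftrightarrow>
    e \<in> orbit (mult_mod k w) d \<and> card (orbit (mult_mod k w) d) = L"
proof (cases "e \<in> orbit (mult_mod k w) d")
  case True
  define n where "n = card {j. j < k \<and> w ^ j * d mod k = e}"
  have n: "n * card (orbit (mult_mod k w) d) = k"
    using card_exponents_times_card_orbit[OF assms True] by (simp add: n_def)
  then have "n * L = k \<longleftrightarrow> n * L = n * card (orbit (mult_mod k w) d)" by simp
  moreover have "n \<noteq> 0" using n k_pos by (cases "n = 0") auto
  ultimately show ?thesis using True unfolding n_def[symmetric] by (metis mult_left_cancel)
next
  case False
  then have empty: "{j. j < k \<and> w ^ j * d mod k = e} = {}"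
    by (auto simp: orbit_mult_mod[OF assms])
  show ?thesis
    unfolding empty using False k_pos by simp
qed

section \<open>Codegrees in the graph\<close>

lemma codegree_G_graph:
  assumes "p < k" "i < k" "p' < k" "i' < k"
  shows "codegree (with_proj (G_graph k w)) (p, i) (p', i') =
    card {j. j < k \<and> (p + w ^ j * i) mod k = (p' + w ^ j * i') mod k}"
proof -
  have "{z \<in> verts (with_proj (G_graph k w)).
           ((p, i), z) \<in> arcs_ends (with_proj (G_graph k w)) \<and>
           ((p', i'), z) \<in> arcs_ends (with_proj (G_graph k w))} =
        (\<lambda>j. ((p + w ^ j * i) mod k, j)) `
          {j. j < k \<and> (p + w ^ j * i) mod k = (p' + w ^ j * i') mod k}"
    using assms by (auto simp: G_graph_def)
  then show ?thesis
    by (simp add: codegree_def card_image inj_on_def)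
qed

text \<open>
  Out-neighbours along \<open>j\<close> have first components that differ by \<open>w\<^sup>j d - e\<close>, whatever \<open>(p, i)\<close>
  is.  The summand \<open>k - e\<close> stands for \<open>- e\<close> modulo \<open>k\<close>.
\<close>

lemma codegree_relative:
  assumes "p < k" "i < k" "e < k" "d < k"
  shows "codegree (with_proj (G_graph k w)) (p, i) ((p + (k - e)) mod k, (i + d) mod k) =
    card {j. j < k \<and> w ^ j * d mod k = e}"
proof -
  have "(p + w ^ j * i) mod k = ((p + (k - e)) mod k + w ^ j * ((i + d) mod k)) mod k \<longleftrightarrow>
    w ^ j * d mod k = e" for j
  proof -
    have "[(p + (k - e)) mod k + w ^ j * ((i + d) mod k) =
        (p + (k - e)) + w ^ j * (i + d)] (mod k)"
      by (intro cong_add cong_mult cong_refl) (simp_all add: cong_def)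
    also have "(p + (k - e)) + w ^ j * (i + d) = (p + w ^ j * i) + ((k - e) + w ^ j * d)"
      by (simp only: distrib_left add_ac)
    finally have "(p + w ^ j * i) mod k = ((p + (k - e)) mod k + w ^ j * ((i + d) mod k)) mod k \<longleftrightarrow>
        [(p + w ^ j * i) + 0 = (p + w ^ j * i) + ((k - e) + w ^ j * d)] (mod k)"
      by (simp add: cong_def)
    also have "\<dots> \<longleftrightarrow> [0 = (k - e) + w ^ j * d] (mod k)"
      by (rule cong_add_lcancel_nat)
    also have "\<dots> \<longleftrightarrow> [e + 0 = e + ((k - e) + w ^ j * d)] (mod k)"
      by (rule cong_add_lcancel_nat[symmetric])
    also have "e + ((k - e) + w ^ j * d) = k + w ^ j * d"
      using assms(3) by simp
    also have "[e + 0 = k + w ^ j * d] (mod k) \<longleftrightarrow> w ^ j * d mod k = e"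
      using assms(3) by (auto simp: cong_def)
    finally show ?thesis .
  qed
  then show ?thesis
    using assms k_pos by (simp add: codegree_G_graph)
qed

lemma bij_betw_relative:
  "bij_betw (\<lambda>(e, d). ((p + (k - e)) mod k, (i + d) mod k)) ({..<k} \<times> {..<k}) ({..<k} \<times> {..<k})"
proof -
  have "inj_on (\<lambda>e. (p + (k - e)) mod k) {..<k}"
  proof (rule inj_onI)
    fix x y assume xy: "x \<in> {..<k}" "y \<in> {..<k}" "(p + (k - x)) mod k = (p + (k - y)) mod k"
    from xy(3) have "[k - x = k - y] (mod k)"
      by (simp only: cong_add_lcancel_nat flip: cong_def)
    \<comment> \<open>Adding \<open>x + y\<close> on both sides removes the truncated subtractions.\<close>
    then have "[x + y + (k - x) = x + y + (k - y)] (mod k)"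
      by (simp only: cong_add_lcancel_nat)
    moreover have "x + y + (k - x) = y + k" "x + y + (k - y) = x + k"
      using xy by auto
    ultimately show "x = y"
      using xy by (simp add: cong_def)
  qed
  then have "inj_on (map_prod (\<lambda>e. (p + (k - e)) mod k) (\<lambda>d. (i + d) mod k)) ({..<k} \<times> {..<k})"
    by (rule map_prod_inj_on[OF _ inj_on_add_mod])
  moreover have "map_prod (\<lambda>e. (p + (k - e)) mod k) (\<lambda>d. (i + d) mod k) ` ({..<k} \<times> {..<k})
      \<subseteq> {..<k} \<times> {..<k}"
    using k_pos by auto
  ultimately show ?thesis
    by (simp add: bij_betw_def endo_inj_surj map_prod_def)
qed

text \<open>
  The condition \<open>codegree * L = k\<close> says that the codegree is \<open>k / L\<close> and excludes codegree \<open>0\<close>,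
  so it singles out the vertices whose offset \<open>(e, d)\<close> has \<open>d\<close> on a cycle of length \<open>L\<close> and \<open>e\<close>
  on the same cycle.
\<close>

lemma card_vertices_of_codegree:
  assumes "u \<in> verts (with_proj (G_graph k w))"
  shows "card {v \<in> verts (with_proj (G_graph k w)). codegree (with_proj (G_graph k w)) u v * L = k} =
    L * card {d \<in> {..<k}. card (orbit (mult_mod k w) d) = L}"
proof -
  let ?G = "with_proj (G_graph k w)" and ?O = "orbit (mult_mod k w)"
  let ?D = "{d \<in> {..<k}. card (?O d) = L}"
  have V: "verts ?G = {..<k} \<times> {..<k}" by (simp add: G_graph_def)
  obtain p i where u: "u = (p, i)" "p < k" "i < k" using assms V by auto
  have sub: "?O d \<subseteq> {..<k}" if "d < k" for d
    using k_pos that by (auto simp: orbit_mult_mod)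
  have "card {v \<in> verts ?G. codegree ?G u v * L = k} =
      card {(e, d) \<in> {..<k} \<times> {..<k}. card {j. j < k \<and> w ^ j * d mod k = e} * L = k}"
    unfolding V u(1)
    by (subst card_Collect_bij_betw[OF bij_betw_relative[of p i]])
      (use u(2,3) in \<open>auto simp: codegree_relative simp del: Nat.add_diff_assoc intro!: arg_cong[of _ _ card]\<close>)
  also have "{(e, d) \<in> {..<k} \<times> {..<k}. card {j. j < k \<and> w ^ j * d mod k = e} * L = k} =
      prod.swap ` Sigma ?D ?O"
    using sub by (fastforce simp: card_exponents_times_eq_iff image_iff)
  also have "card \<dots> = card (Sigma ?D ?O)"
    by (simp add: card_image)
  also have "\<dots> = L * card ?D"
    using sub by (subst card_SigmaI) (auto intro: finite_subset)
  finally show ?thesis .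
qed

end

section \<open>The graph determines the cycle type\<close>

theorem theorem3:
  fixes k w1 w2 c1 c2 :: nat
  assumes "k > 0"
    and "w1 < k" and "coprime k w1" and "ord k w1 = c1" and "c1 dvd k"
    and "w2 < k" and "coprime k w2" and "ord k w2 = c2" and "c2 dvd k"
    and "digraph_iso (with_proj (G_graph k w1)) (with_proj (G_graph k w2))"
  shows "bij_betw (mult_mod k w1) {..<k} {..<k} \<and>
         bij_betw (mult_mod k w2) {..<k} {..<k} \<and>
         cycle_type {..<k} (mult_mod k w1) = cycle_type {..<k} (mult_mod k w2) \<and>
         c1 = c2"
proof -
  let ?G = "\<lambda>w. with_proj (G_graph k w)"
  have period: "[w1 ^ k = 1] (mod k)" "[w2 ^ k = 1] (mod k)"
    using assms(4,5,8,9) by (simp_all only: ord_divides)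
  obtain f where f: "bij_betw f (verts (?G w1)) (verts (?G w2))"
    and codeg: "\<And>u P. u \<in> verts (?G w1) \<Longrightarrow>
      card {v \<in> verts (?G w2). P (codegree (?G w2) (f u) v)} =
      card {v \<in> verts (?G w1). P (codegree (?G w1) u v)}"
    using digraph_iso_card_codegree[OF assms(10)] by blast
  have u: "(0, 0) \<in> verts (?G w1)" using assms(1) by (simp add: G_graph_def)
  then have fu: "f (0, 0) \<in> verts (?G w2)" using f by (auto simp: bij_betw_def)
  have "L * card {d \<in> {..<k}. card (orbit (mult_mod k w1) d) = L} =
      L * card {d \<in> {..<k}. card (orbit (mult_mod k w2) d) = L}" for L
    using codeg[OF u, of "\<lambda>m. m * L = k", symmetric]
    unfolding card_vertices_of_codegree[OF assms(1) period(1) u]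
      card_vertices_of_codegree[OF assms(1) period(2) fu] .
  then have "cycle_type {..<k} (mult_mod k w1) = cycle_type {..<k} (mult_mod k w2)"
    using mult_mod_maps[OF assms(1)] self_in_orbit_mult_mod[OF assms(1)] period
    by (intro cycle_type_eqI) auto
  then show ?thesis
    using bij_betw_mult_mod ord_eq_Max_cycle_type assms by metis
qed

end
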